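(* Let $p\ge2$ be a prime and $\mathbb{X}_p\in\{\mathbb{Z}_p,\mathbb{Q}_p\}$. There exists a continuous map $f:\mathbb{X}_p\to\mathbb{X}_p$ which admits a contraction $R:\mathbb{X}_p\to\mathbb{X}_p$ (i.e. $\mathrm{Lip}(R)<1$) as a right inverse ($f\circ R=\mathrm{id}$), but such that $f$ does not have the shadowing property, is not Lipschitz structurally stable, and is not topologically stable.
   Context: $\mathbb{Z}_p$, $\mathbb{Q}_p$ are the $p$-adic integers and numbers with the $p$-adic norm $\|\cdot\|_p$. $\|\phi\|_\infty=\sup_x\|\phi(x)\|_p$, $\mathrm{Lip}(\phi)=\sup_{x\ne y}\|\phi(x)-\phi(y)\|_p/\|x-y\|_p$, and $\mathrm{Lip}_\delta(\mathbb{X}_p)=\{\phi:\mathbb{X}_p\to\mathbb{X}_p:\mathrm{Lip}(\phi)\le\delta,\ \|\phi\|_\infty\le\delta\}$. A $\delta$-pseudo-orbit of $f$ is a sequence $(x_n)_{n\ge0}$ with $\|f(x_n)-x_{n+1}\|_p\le\delta$ for all $n$. Shadowing: for every $\varepsilon>0$ there is $\delta>0$ such that every $\delta$-pseudo-orbit $(x_n)$ admits $x$ with $\|x_n-f^n(x)\|_p\le\varepsilon$ for all $n\ge0$. Lipschitz structurally stable: there is $\delta>0$ such that for every $\phi\in\mathrm{Lip}_\delta(\mathbb{X}_p)$ there is a homeomorphism $h:\mathbb{X}_p\to\mathbb{X}_p$ with $f\circ h=h\circ(f+\phi)$. Topologically stable: for every $\varepsilon>0$ there is $\delta>0$ such that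 for every continuous $g$ with $\|f-g\|_\infty\le\delta$ there is a continuous $h$ with $\|h-\mathrm{id}\|_\infty\le\varepsilon$ and $f\circ h=h\circ g$. *)

theory Defs
  imports "HOL-Analysis.Analysis" "Berlekamp_Zassenhaus.Finite_Field"
begin

section \<open>The \<open>p\<close>-adic absolute value on the rationals\<close>

text \<open>
  For \<open>q = a / b\<close> the value is \<open>p\<^bsup>-v(q)\<^esup>\<close> with valuation \<open>v(q) = v(a) - v(b)\<close>;
  \<open>quotient_of q\<close> is the reduced pair \<open>(a, b)\<close>.
\<close>

definition padic_abs :: "nat \<Rightarrow> rat \<Rightarrow> real" where
  "padic_abs p q =
     (if q = 0 then 0
      else real p powi (int (multiplicity (int p) (snd (quotient_of q)))
                      - int (multiplicity (int p) (fst (quotient_of q)))))"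

definition padic_cauchy :: "nat \<Rightarrow> (nat \<Rightarrow> rat) \<Rightarrow> bool" where
  "padic_cauchy p X \<longleftrightarrow>
     (\<forall>e>0. \<exists>M. \<forall>m\<ge>M. \<forall>n\<ge>M. padic_abs p (X m - X n) < e)"

definition padic_null :: "nat \<Rightarrow> (nat \<Rightarrow> rat) \<Rightarrow> bool" where
  "padic_null p X \<longleftrightarrow> (\<lambda>n. padic_abs p (X n)) \<longlonglongrightarrow> 0"

definition padic_rel :: "nat \<Rightarrow> (nat \<Rightarrow> rat) \<Rightarrow> (nat \<Rightarrow> rat) \<Rightarrow> bool" where
  "padic_rel p X Y \<longleftrightarrow>
     padic_cauchy p X \<and> padic_cauchy p Y \<and> padic_null p (\<lambda>n. X n - Y n)"

lemma padic_abs_0 [simp]: "padic_abs p 0 = 0"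
  by (simp add: padic_abs_def)

lemma padic_abs_nonneg [simp]: "0 \<le> padic_abs p q"
  by (simp add: padic_abs_def)

context
  fixes p :: nat
  assumes p: "prime p"
begin

lemma padic_abs_divide_int:
  assumes "a \<noteq> 0" "b \<noteq> 0"
  shows "padic_abs p (of_int a / of_int b) =
    real p powi (int (multiplicity (int p) b) - int (multiplicity (int p) a))"
proof -
  obtain c d where cd: "quotient_of (of_int a / of_int b) = (c, d)"
    by (metis surj_pair)
  have d: "d > 0" using quotient_of_denom_pos[OF cd] .
  have eq: "(of_int a / of_int b :: rat) = of_int c / of_int d"
    using quotient_of_div[OF cd] .
  have c: "c \<noteq> 0"
    using eq assms d by auto
  have "of_int (a * d) = (of_int (c * b) :: rat)"
    using eq assms d by (simp add: field_simps)
  then have e: "a * d = c * b"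
    by (simp only: of_int_eq_iff)
  have "prime_elem (int p)" using p by auto
  then have "multiplicity (int p) a + multiplicity (int p) d
       = multiplicity (int p) c + multiplicity (int p) b"
    using e assms c d by (metis less_numeral_extra(3) prime_elem_multiplicity_mult_distrib)
  then show ?thesis
    using assms cd by (auto simp: padic_abs_def intro!: arg_cong[where f="\<lambda>k. real p powi k"])
qed

lemma rat_quotient_cases:
  fixes q :: rat
  obtains a b where "q = of_int a / of_int b" "b \<noteq> 0" "a = 0 \<longleftrightarrow> q = 0"
proof -
  obtain a b where cd: "quotient_of q = (a, b)" by (metis surj_pair)
  show ?thesis
    using that[of a b] quotient_of_div[OF cd] quotient_of_denom_pos[OF cd] by auto
qed

lemma padic_abs_eq_0_iff [simp]: "padic_abs p q = 0 \<longleftrightarrow> q = 0"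
  using p by (auto simp: padic_abs_def power_int_eq_0_iff)

lemma padic_abs_mult: "padic_abs p (q * r) = padic_abs p q * padic_abs p r"
proof (cases "q = 0 \<or> r = 0")
  case False
  obtain a b where ab: "q = of_int a / of_int b" "b \<noteq> 0" "a \<noteq> 0"
    using False rat_quotient_cases by metis
  obtain c d where cd: "r = of_int c / of_int d" "d \<noteq> 0" "c \<noteq> 0"
    using False rat_quotient_cases by metis
  have "q * r = of_int (a * c) / of_int (b * d)"
    using ab cd by simp
  then have "padic_abs p (q * r) = real p powi
      (int (multiplicity (int p) (b * d)) - int (multiplicity (int p) (a * c)))"
    using padic_abs_divide_int[of "a * c" "b * d"] ab cd by simp
  moreover have "prime_elem (int p)" "real p \<noteq> 0" using p by (auto simp: prime_gt_0_nat)
  ultimately show ?thesis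
    using ab cd padic_abs_divide_int[of a b] padic_abs_divide_int[of c d]
    by (simp add: prime_elem_multiplicity_mult_distrib power_int_add[symmetric] algebra_simps)
qed auto

lemma padic_abs_1 [simp]: "padic_abs p 1 = 1"
  using padic_abs_divide_int[of 1 1] by simp

lemma padic_abs_minus [simp]: "padic_abs p (- q) = padic_abs p q"
proof -
  have "padic_abs p (-1) = 1"
    using padic_abs_divide_int[of "-1" 1] by (simp add: multiplicity_unit_right)
  then show ?thesis
    using padic_abs_mult[of "-1" q] by simp
qed

lemma padic_abs_inverse: "padic_abs p (inverse q) = inverse (padic_abs p q)"
proof (cases "q = 0")
  case False
  then have "padic_abs p q * padic_abs p (inverse q) = 1"
    by (simp flip: padic_abs_mult)
  then show ?thesis
    by (metis inverse_unique)
qed auto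

lemma padic_abs_p: "padic_abs p (of_nat p) = inverse (real p)"
  using padic_abs_divide_int[of "int p" 1] p by (auto simp: power_int_minus)

lemma padic_abs_ultrametric: "padic_abs p (q + r) \<le> max (padic_abs p q) (padic_abs p r)"
proof (cases "q = 0 \<or> r = 0 \<or> q + r = 0")
  case True
  then show ?thesis by (auto simp: le_max_iff_disj)
next
  case False
  obtain a b where ab: "q = of_int a / of_int b" "b \<noteq> 0" "a \<noteq> 0"
    using False rat_quotient_cases by metis
  obtain c d where cd: "r = of_int c / of_int d" "d \<noteq> 0" "c \<noteq> 0"
    using False rat_quotient_cases by metis
  let ?m = "multiplicity (int p)"
  have q: "q = of_int (a * d) / of_int (b * d)" and r: "r = of_int (c * b) / of_int (b * d)"
    and qr: "q + r = of_int (a * d + c * b) / of_int (b * d)"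
    using ab cd by (simp_all add: field_simps)
  have nz: "a * d + c * b \<noteq> 0"
  proof
    assume "a * d + c * b = 0"
    then have "q + r = 0" unfolding qr by (simp only: of_int_0 div_0)
    then show False using False by simp
  qed
  have "min (?m (a * d)) (?m (c * b)) \<le> ?m (a * d + c * b)"
    using p nz by (intro multiplicity_geI dvd_add) (auto intro!: multiplicity_dvd')
  then have "?m (a * d) \<le> ?m (a * d + c * b) \<or> ?m (c * b) \<le> ?m (a * d + c * b)"
    by linarith
  moreover have "real p \<ge> 1"
    using prime_ge_1_nat[OF p] by simp
  moreover have "padic_abs p q = real p powi (int (?m (b * d)) - int (?m (a * d)))"
    "padic_abs p r = real p powi (int (?m (b * d)) - int (?m (c * b)))"
    using ab cd padic_abs_divide_int[of "a * d" "b * d"] padic_abs_divide_int[of "c * b" "b * d"] q r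
    by simp_all
  moreover have "padic_abs p (q + r) = real p powi (int (?m (b * d)) - int (?m (a * d + c * b)))"
    unfolding qr using ab cd nz by (intro padic_abs_divide_int) auto
  ultimately show ?thesis
    by (auto simp: le_max_iff_disj intro!: power_int_increasing)
qed

lemma padic_abs_triangle: "padic_abs p (q + r) \<le> padic_abs p q + padic_abs p r"
  using padic_abs_ultrametric[of q r] padic_abs_nonneg[of p q] padic_abs_nonneg[of p r]
  by linarith

lemma padic_abs_minus_commute: "padic_abs p (q - r) = padic_abs p (r - q)"
  using padic_abs_minus[of "q - r"] by simp

lemma padic_abs_diff_ineq: "\<bar>padic_abs p q - padic_abs p r\<bar> \<le> padic_abs p (q - r)"
  using padic_abs_triangle[of "q - r" r] padic_abs_triangle[of "r - q" q]
    padic_abs_minus_commute[of q r]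
  by simp

lemma padic_cauchyD:
  "padic_cauchy p X \<Longrightarrow> 0 < e \<Longrightarrow> \<exists>M. \<forall>m\<ge>M. \<forall>n\<ge>M. padic_abs p (X m - X n) < e"
  by (auto simp: padic_cauchy_def)

lemma padic_cauchy_const [simp]: "padic_cauchy p (\<lambda>n. c)"
  by (simp add: padic_cauchy_def)

lemma padic_cauchy_add:
  assumes "padic_cauchy p X" "padic_cauchy p Y"
  shows "padic_cauchy p (\<lambda>n. X n + Y n)"
  unfolding padic_cauchy_def
proof (intro allI impI)
  fix e :: real assume e: "e > 0"
  obtain M where M: "\<forall>m\<ge>M. \<forall>n\<ge>M. padic_abs p (X m - X n) < e"
    using padic_cauchyD[OF assms(1) e] by blast
  obtain N where N: "\<forall>m\<ge>N. \<forall>n\<ge>N. padic_abs p (Y m - Y n) < e"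
    using padic_cauchyD[OF assms(2) e] by blast
  have "padic_abs p (X m + Y m - (X n + Y n)) < e" if "m \<ge> max M N" "n \<ge> max M N" for m n
    using padic_abs_ultrametric[of "X m - X n" "Y m - Y n"] M N that
    by (simp add: algebra_simps) (smt (verit))
  then show "\<exists>K. \<forall>m\<ge>K. \<forall>n\<ge>K. padic_abs p (X m + Y m - (X n + Y n)) < e"
    by blast
qed

lemma padic_cauchy_minus: "padic_cauchy p X \<Longrightarrow> padic_cauchy p (\<lambda>n. - X n)"
  by (simp add: padic_cauchy_def padic_abs_minus_commute)

lemma padic_cauchy_diff:
  "padic_cauchy p X \<Longrightarrow> padic_cauchy p Y \<Longrightarrow> padic_cauchy p (\<lambda>n. X n - Y n)"
  using padic_cauchy_add[of X "\<lambda>n. - Y n"] padic_cauchy_minus[of Y] by simp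

lemma padic_cauchy_convergent_abs:
  assumes "padic_cauchy p X"
  shows "convergent (\<lambda>n. padic_abs p (X n))"
  unfolding Cauchy_convergent_iff[symmetric]
proof (rule CauchyI)
  fix e :: real assume e: "e > 0"
  obtain M where M: "\<forall>m\<ge>M. \<forall>n\<ge>M. padic_abs p (X m - X n) < e"
    using padic_cauchyD[OF assms e] by blast
  show "\<exists>M. \<forall>m\<ge>M. \<forall>n\<ge>M. norm (padic_abs p (X m) - padic_abs p (X n)) < e"
    using M by (intro exI[of _ M]) (auto intro: le_less_trans[OF padic_abs_diff_ineq])
qed

lemma padic_cauchy_bounded:
  assumes "padic_cauchy p X"
  obtains B where "B > 0" "\<And>n. padic_abs p (X n) \<le> B"
proof -
  have "Bseq (\<lambda>n. padic_abs p (X n))"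
    using padic_cauchy_convergent_abs[OF assms] convergent_imp_Bseq by blast
  then show ?thesis
    using that by (auto simp: Bseq_def)
qed

lemma padic_cauchy_mult:
  assumes "padic_cauchy p X" "padic_cauchy p Y"
  shows "padic_cauchy p (\<lambda>n. X n * Y n)"
  unfolding padic_cauchy_def
proof (intro allI impI)
  fix e :: real assume e: "e > 0"
  obtain A where A: "A > 0" "\<And>n. padic_abs p (X n) \<le> A"
    using padic_cauchy_bounded[OF assms(1)] by blast
  obtain B where B: "B > 0" "\<And>n. padic_abs p (Y n) \<le> B"
    using padic_cauchy_bounded[OF assms(2)] by blast
  obtain M where M: "\<forall>m\<ge>M. \<forall>n\<ge>M. padic_abs p (X m - X n) < e / B"
    using padic_cauchyD[OF assms(1), of "e / B"] e B by auto
  obtain N where N: "\<forall>m\<ge>N. \<forall>n\<ge>N. padic_abs p (Y m - Y n) < e / A"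
    using padic_cauchyD[OF assms(2), of "e / A"] e A by auto
  have "padic_abs p (X m * Y m - X n * Y n) < e" if "m \<ge> max M N" "n \<ge> max M N" for m n
  proof -
    have "padic_abs p (X m) * padic_abs p (Y m - Y n) \<le> A * padic_abs p (Y m - Y n)"
      using A by (intro mult_right_mono) auto
    also have "\<dots> < e"
      using N that A by (simp add: field_simps)
    finally have 1: "padic_abs p (X m * (Y m - Y n)) < e"
      by (simp add: padic_abs_mult)
    have "padic_abs p (X m - X n) * padic_abs p (Y n) \<le> padic_abs p (X m - X n) * B"
      using B by (intro mult_left_mono) auto
    also have "\<dots> < e"
      using M that B by (simp add: field_simps)
    finally have 2: "padic_abs p ((X m - X n) * Y n) < e"
      by (simp add: padic_abs_mult)
    have "X m * Y m - X n * Y n = X m * (Y m - Y n) + (X m - X n) * Y n"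
      by (simp add: algebra_simps)
    then show ?thesis
      using padic_abs_ultrametric[of "X m * (Y m - Y n)" "(X m - X n) * Y n"] 1 2
      by (metis le_less_trans max_less_iff_conj)
  qed
  then show "\<exists>K. \<forall>m\<ge>K. \<forall>n\<ge>K. padic_abs p (X m * Y m - X n * Y n) < e"
    by blast
qed

lemma padic_null_const [simp]: "padic_null p (\<lambda>n. c) \<longleftrightarrow> c = 0"
  by (simp add: padic_null_def LIMSEQ_const_iff)

lemma padic_null_minus_iff [simp]: "padic_null p (\<lambda>n. - X n) \<longleftrightarrow> padic_null p X"
  by (simp add: padic_null_def)

lemma padic_null_diff_commute:
  "padic_null p (\<lambda>n. X n - Y n) \<Longrightarrow> padic_null p (\<lambda>n. Y n - X n)"
  by (simp add: padic_null_def padic_abs_minus_commute)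

lemma padic_null_add:
  assumes "padic_null p X" "padic_null p Y"
  shows "padic_null p (\<lambda>n. X n + Y n)"
  unfolding padic_null_def
  by (rule tendsto_sandwich[OF _ _ tendsto_const
        tendsto_add_zero[OF assms[unfolded padic_null_def]]])
     (auto intro!: always_eventually padic_abs_triangle)

lemma padic_null_mult:
  assumes "padic_cauchy p X" "padic_null p Y"
  shows "padic_null p (\<lambda>n. X n * Y n)"
proof -
  obtain B where B: "\<And>n. padic_abs p (X n) \<le> B"
    using padic_cauchy_bounded[OF assms(1)] by blast
  have lim: "(\<lambda>n. B * padic_abs p (Y n)) \<longlonglongrightarrow> 0"
    using tendsto_mult_right_zero[OF assms(2)[unfolded padic_null_def]] .
  show ?thesis
    unfolding padic_null_def padic_abs_mult
    by (rule tendsto_sandwich[OF _ _ tendsto_const lim])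
       (auto intro!: always_eventually mult_right_mono B)
qed

lemma padic_cauchy_not_null:
  assumes "padic_cauchy p X" "\<not> padic_null p X"
  obtains b M where "b > 0" "\<And>n. n \<ge> M \<Longrightarrow> padic_abs p (X n) > b"
proof -
  obtain L where L: "(\<lambda>n. padic_abs p (X n)) \<longlonglongrightarrow> L"
    using padic_cauchy_convergent_abs[OF assms(1)] convergent_def by blast
  have "L \<ge> 0"
    using LIMSEQ_le_const[OF L, of 0] by auto
  moreover have "L \<noteq> 0"
    using L assms(2) by (auto simp: padic_null_def)
  ultimately have "L > 0" by simp
  then have "eventually (\<lambda>n. padic_abs p (X n) > L / 2) sequentially"
    using order_tendstoD(1)[OF L, of "L / 2"] by simp
  then show ?thesis
    using that[of "L / 2"] \<open>L > 0\<close> unfolding eventually_sequentially by auto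
qed

lemma padic_abs_diff_inverse:
  assumes "x \<noteq> 0" "y \<noteq> 0"
  shows "padic_abs p (inverse x - inverse y) = padic_abs p (x - y) / (padic_abs p x * padic_abs p y)"
proof -
  have "inverse x - inverse y = (y - x) * inverse x * inverse y"
    using assms by (simp add: field_simps)
  then show ?thesis
    by (simp only: padic_abs_mult padic_abs_inverse padic_abs_minus_commute[of y x]
        divide_inverse inverse_mult_distrib mult.assoc)
qed

lemma padic_abs_diff_inverse_less:
  assumes "b > 0" "padic_abs p x > b" "c > 0" "padic_abs p y > c" "padic_abs p (x - y) < e * (b * c)"
  shows "padic_abs p (inverse x - inverse y) < e"
proof -
  have xy: "x \<noteq> 0" "y \<noteq> 0" using assms by auto
  have e: "e > 0"
    using assms padic_abs_nonneg[of p "x - y"] by (smt (verit) mult_pos_pos zero_less_mult_pos2)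
  have "b * c \<le> padic_abs p x * padic_abs p y"
    using assms by (intro mult_mono) auto
  then have "e * (b * c) \<le> e * (padic_abs p x * padic_abs p y)"
    using e by (intro mult_left_mono) auto
  then have "padic_abs p (x - y) < e * (padic_abs p x * padic_abs p y)"
    using assms by linarith
  moreover have "padic_abs p x * padic_abs p y > 0"
    using assms by (intro mult_pos_pos) linarith+
  ultimately show ?thesis
    unfolding padic_abs_diff_inverse[OF xy] by (simp add: divide_less_eq)
qed

lemma padic_cauchy_inverse:
  assumes "padic_cauchy p X" "\<not> padic_null p X"
  shows "padic_cauchy p (\<lambda>n. inverse (X n))"
  unfolding padic_cauchy_def
proof (intro allI impI)
  fix e :: real assume e: "e > 0"
  obtain b M where b: "b > 0" "\<And>n. n \<ge> M \<Longrightarrow> padic_abs p (X n) > b"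
    using padic_cauchy_not_null[OF assms] by blast
  obtain N where N: "\<forall>m\<ge>N. \<forall>n\<ge>N. padic_abs p (X m - X n) < e * (b * b)"
    using padic_cauchyD[OF assms(1), of "e * (b * b)"] e b by auto
  show "\<exists>K. \<forall>m\<ge>K. \<forall>n\<ge>K. padic_abs p (inverse (X m) - inverse (X n)) < e"
    using b N by (intro exI[of _ "max M N"]) (auto intro!: padic_abs_diff_inverse_less[of b _ b])
qed

lemma padic_null_diff_inverse:
  assumes X: "padic_cauchy p X" "\<not> padic_null p X"
    and Y: "padic_cauchy p Y" "\<not> padic_null p Y"
    and XY: "padic_null p (\<lambda>n. X n - Y n)"
  shows "padic_null p (\<lambda>n. inverse (X n) - inverse (Y n))"
  unfolding padic_null_def
proof (rule LIMSEQ_I)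
  fix e :: real assume e: "e > 0"
  obtain b M where b: "b > 0" "\<And>n. n \<ge> M \<Longrightarrow> padic_abs p (X n) > b"
    using padic_cauchy_not_null[OF X] by blast
  obtain c K where c: "c > 0" "\<And>n. n \<ge> K \<Longrightarrow> padic_abs p (Y n) > c"
    using padic_cauchy_not_null[OF Y] by blast
  obtain N where N: "\<forall>n\<ge>N. padic_abs p (X n - Y n) < e * (b * c)"
    using LIMSEQ_D[OF XY[unfolded padic_null_def], of "e * (b * c)"] e b c by auto
  show "\<exists>no. \<forall>n\<ge>no. norm (padic_abs p (inverse (X n) - inverse (Y n)) - 0) < e"
    using b c N
    by (intro exI[of _ "max M (max K N)"]) (auto intro!: padic_abs_diff_inverse_less[of b _ c])
qed

lemma part_equivp_padic_rel: "part_equivp (padic_rel p)"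
proof (rule part_equivpI)
  show "\<exists>x. padic_rel p x x"
    by (intro exI[of _ "\<lambda>_. 0"]) (simp add: padic_rel_def)
  show "symp (padic_rel p)"
    using padic_null_diff_commute by (intro sympI) (simp add: padic_rel_def)
  show "transp (padic_rel p)"
  proof (rule transpI)
    fix X Y Z
    assume "padic_rel p X Y" "padic_rel p Y Z"
    then show "padic_rel p X Z"
      using padic_null_add[of "\<lambda>n. X n - Y n" "\<lambda>n. Y n - Z n"] by (simp add: padic_rel_def)
  qed
qed

lemma padic_rel_lim_abs:
  assumes "padic_rel p X Y"
  shows "lim (\<lambda>n. padic_abs p (X n)) = lim (\<lambda>n. padic_abs p (Y n))"
proof -
  have X: "(\<lambda>n. padic_abs p (X n)) \<longlonglongrightarrow> lim (\<lambda>n. padic_abs p (X n))"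
    using assms padic_cauchy_convergent_abs convergent_LIMSEQ_iff by (auto simp: padic_rel_def)
  have "(\<lambda>n. padic_abs p (X n) - padic_abs p (Y n)) \<longlonglongrightarrow> 0"
    using assms unfolding padic_rel_def padic_null_def
    by (rule_tac Lim_null_comparison[where g="\<lambda>n. padic_abs p (X n - Y n)"])
       (auto intro!: always_eventually padic_abs_diff_ineq)
  from tendsto_diff[OF X this] show ?thesis
    by (simp add: limI)
qed

end


section \<open>The field of \<open>p\<close>-adic numbers\<close>

text \<open>
  \<open>'p padic\<close> is \<open>\<rat>\<^sub>p\<close> for the prime \<open>p = CARD('p)\<close>: the completion of the rationals with
  respect to the \<open>p\<close>-adic absolute value, i.e. Cauchy sequences modulo null sequences.
\<close>

typedef ('p::prime_card) padic =
    "{C. \<exists>X. padic_rel CARD('p) X X \<and> C = Collect (padic_rel CARD('p) X)}"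
  morphisms padic_class padic_of_class
proof -
  have "padic_rel CARD('p) (\<lambda>_. 0) (\<lambda>_. 0)"
    by (simp add: padic_rel_def padic_cauchy_const[OF prime_card] padic_null_const[OF prime_card])
  then show ?thesis by blast
qed

definition abs_padic :: "(nat \<Rightarrow> rat) \<Rightarrow> 'p::prime_card padic" where
  "abs_padic X = padic_of_class (Collect (padic_rel CARD('p) X))"

definition rep_padic :: "'p::prime_card padic \<Rightarrow> (nat \<Rightarrow> rat)" where
  "rep_padic x = (SOME X. X \<in> padic_class x)"

definition cr_padic :: "(nat \<Rightarrow> rat) \<Rightarrow> 'p::prime_card padic \<Rightarrow> bool" where
  "cr_padic X x \<longleftrightarrow> padic_rel CARD('p) X X \<and> abs_padic X = x"

lemma Quotient_padic:
  "Quotient (padic_rel CARD('p)) abs_padic rep_padic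
     (cr_padic :: _ \<Rightarrow> 'p::prime_card padic \<Rightarrow> bool)"
proof -
  interpret Q: quot_type "padic_rel CARD('p)"
    "padic_of_class :: _ \<Rightarrow> 'p padic" "padic_class :: 'p padic \<Rightarrow> _"
  proof
    show "part_equivp (padic_rel CARD('p))"
      by (rule part_equivp_padic_rel[OF prime_card])
    show "\<exists>X. padic_rel CARD('p) X X \<and> padic_class x = Collect (padic_rel CARD('p) X)" for x :: "'p padic"
      using padic_class[of x] by simp
    show "padic_class (padic_of_class C :: 'p padic) = C"
      if "\<exists>X. padic_rel CARD('p) X X \<and> C = Collect (padic_rel CARD('p) X)" for C
      using that by (intro padic_of_class_inverse) simp
  qed (simp_all add: padic_class_inverse padic_class_inject)
  have "Q.abs = abs_padic" "Q.rep = rep_padic"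
    by (simp_all add: fun_eq_iff Q.abs_def abs_padic_def Q.rep_def rep_padic_def)
  then have "Quotient3 (padic_rel CARD('p)) (abs_padic :: _ \<Rightarrow> 'p padic) rep_padic"
    using Q.Quotient by simp
  moreover have "cr_padic = (\<lambda>X (x :: 'p padic). padic_rel CARD('p) X X \<and> abs_padic X = x)"
    by (intro ext) (rule cr_padic_def)
  ultimately show ?thesis
    unfolding Quotient3_def Quotient_def by blast
qed

setup_lifting Quotient_padic

lemma abs_padic_eq_iff:
  assumes "padic_cauchy CARD('p) X" "padic_cauchy CARD('p) Y"
  shows "(abs_padic X :: 'p::prime_card padic) = abs_padic Y \<longleftrightarrow> padic_null CARD('p) (\<lambda>n. X n - Y n)"
proof -
  have "padic_rel CARD('p) X Y \<longleftrightarrow> (abs_padic X :: 'p padic) = abs_padic Y"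
    using assms Quotient_rel[OF Quotient_padic[where 'p='p], of X Y]
    by (simp add: padic_rel_def padic_null_const[OF prime_card])
  then show ?thesis
    using assms by (simp add: padic_rel_def)
qed

lemma abs_padic_cases:
  obtains X where "padic_cauchy CARD('p) X" "(x :: 'p::prime_card padic) = abs_padic X"
  using Quotient_abs_rep[OF Quotient_padic, of x] Quotient_rep_reflp[OF Quotient_padic, of x]
  by (metis padic_rel_def)

lemma cr_padic_eq: "pcr_padic = (\<lambda>X (x :: 'p::prime_card padic). padic_cauchy CARD('p) X \<and> abs_padic X = x)"
  by (auto simp: padic.pcr_cr_eq cr_padic_def padic_rel_def fun_eq_iff
      padic_null_const[OF prime_card])

lemma Domainp_pcr_padic [transfer_domain_rule]:
  "Domainp (pcr_padic :: _ \<Rightarrow> 'p::prime_card padic \<Rightarrow> bool) = padic_cauchy CARD('p)"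
  by (auto simp: cr_padic_eq fun_eq_iff)

instantiation padic :: (prime_card) field
begin

lift_definition zero_padic :: "'a padic" is "\<lambda>_. 0"
  by (simp add: padic_rel_def padic_cauchy_const padic_null_const prime_card)

lift_definition one_padic :: "'a padic" is "\<lambda>_. 1"
  by (simp add: padic_rel_def padic_cauchy_const padic_null_const prime_card)

lift_definition plus_padic :: "'a padic \<Rightarrow> 'a padic \<Rightarrow> 'a padic" is "\<lambda>X Y n. X n + Y n"
  unfolding padic_rel_def add_diff_add
  by (simp add: padic_cauchy_add[OF prime_card] padic_null_add[OF prime_card])

lift_definition uminus_padic :: "'a padic \<Rightarrow> 'a padic" is "\<lambda>X n. - X n"
  unfolding padic_rel_def minus_diff_minus
  by (simp add: padic_cauchy_minus[OF prime_card] padic_null_minus_iff[OF prime_card]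
      del: minus_diff_eq)

lift_definition times_padic :: "'a padic \<Rightarrow> 'a padic \<Rightarrow> 'a padic" is "\<lambda>X Y n. X n * Y n"
proof -
  fix X X' Y Y' :: "nat \<Rightarrow> rat"
  note p = prime_card[where 'a='a]
  assume "padic_rel CARD('a) X X'" "padic_rel CARD('a) Y Y'"
  then have "padic_null CARD('a) (\<lambda>n. X n * (Y n - Y' n) + Y' n * (X n - X' n))"
    by (intro padic_null_add[OF p] padic_null_mult[OF p]) (auto simp: padic_rel_def)
  moreover have "(\<lambda>n. X n * (Y n - Y' n) + Y' n * (X n - X' n)) = (\<lambda>n. X n * Y n - X' n * Y' n)"
    by (simp add: algebra_simps)
  ultimately show "padic_rel CARD('a) (\<lambda>n. X n * Y n) (\<lambda>n. X' n * Y' n)"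
    using \<open>padic_rel CARD('a) X X'\<close> \<open>padic_rel CARD('a) Y Y'\<close>
    by (simp add: padic_rel_def padic_cauchy_mult[OF p])
qed

lift_definition inverse_padic :: "'a padic \<Rightarrow> 'a padic" is
  "\<lambda>X. if padic_null CARD('a) X then (\<lambda>_. 0) else (\<lambda>n. inverse (X n))"
proof -
  fix X Y :: "nat \<Rightarrow> rat"
  note p = prime_card[where 'a='a]
  assume XY: "padic_rel CARD('a) X Y"
  then have d: "padic_null CARD('a) (\<lambda>n. X n - Y n)" "padic_null CARD('a) (\<lambda>n. Y n - X n)"
    using padic_null_diff_commute[OF p] by (auto simp: padic_rel_def)
  have "padic_null CARD('a) X \<longleftrightarrow> padic_null CARD('a) Y"
    using padic_null_add[OF p d(2), of X] padic_null_add[OF p d(1), of Y] by auto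
  then show "padic_rel CARD('a)
      (if padic_null CARD('a) X then (\<lambda>_. 0) else (\<lambda>n. inverse (X n)))
      (if padic_null CARD('a) Y then (\<lambda>_. 0) else (\<lambda>n. inverse (Y n)))"
    using XY padic_null_diff_inverse[OF p] padic_cauchy_inverse[OF p]
    by (auto simp: padic_rel_def padic_cauchy_const[OF p] padic_null_const[OF p])
qed

definition minus_padic :: "'a padic \<Rightarrow> 'a padic \<Rightarrow> 'a padic" where
  "minus_padic x y = x + (- y)"

definition divide_padic :: "'a padic \<Rightarrow> 'a padic \<Rightarrow> 'a padic" where
  "divide_padic x y = x * inverse y"

instance
proof
  note p = prime_card[where 'a='a]
  note [simp] = padic_rel_def padic_cauchy_const[OF p] padic_null_const[OF p]
    padic_cauchy_add[OF p] padic_cauchy_mult[OF p] padic_cauchy_minus[OF p]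
  fix a b c :: "'a padic"
  show "a + b = b + a" by transfer (simp add: ac_simps)
  show "(a + b) + c = a + (b + c)" by transfer (simp add: ac_simps)
  show "0 + a = a" by transfer simp
  show "- a + a = 0" by transfer simp
  show "a - b = a + - b" by (rule minus_padic_def)
  show "(a * b) * c = a * (b * c)" by transfer (simp add: ac_simps)
  show "a * b = b * a" by transfer (simp add: ac_simps)
  show "1 * a = a" by transfer simp
  show "(a + b) * c = a * c + b * c" by transfer (simp add: algebra_simps)
  show "(0 :: 'a padic) \<noteq> 1" by transfer simp
  show "inverse (0 :: 'a padic) = 0" by transfer simp
  show "a div b = a * inverse b" by (rule divide_padic_def)
  show "inverse a * a = 1" if "a \<noteq> 0"
    using that
  proof transfer
    fix X :: "nat \<Rightarrow> rat"
    assume X: "padic_cauchy CARD('a) X" "\<not> padic_rel CARD('a) X (\<lambda>_. 0)"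
    then have nn: "\<not> padic_null CARD('a) X" by simp
    obtain b M where b: "b > 0" "\<And>n. n \<ge> M \<Longrightarrow> padic_abs CARD('a) (X n) > b"
      using padic_cauchy_not_null[OF p X(1) nn] by blast
    have "X n \<noteq> 0" if "n \<ge> M" for n
    proof
      assume "X n = 0"
      then show False using b(1) b(2)[OF that] by simp
    qed
    then have "eventually (\<lambda>n. padic_abs CARD('a) (inverse (X n) * X n - 1) = 0) sequentially"
      unfolding eventually_sequentially by (intro exI[of _ M]) simp
    then have "padic_null CARD('a) (\<lambda>n. inverse (X n) * X n - 1)"
      unfolding padic_null_def by (rule tendsto_eventually)
    then show "padic_rel CARD('a)
        (\<lambda>n. (if padic_null CARD('a) X then \<lambda>_. 0 else (\<lambda>n. inverse (X n))) n * X n) (\<lambda>_. 1)"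
      using X nn by (simp add: padic_cauchy_inverse[OF p])
  qed
qed

end

text \<open>
  The continuous extension of the absolute value. The constant \<open>norm\<close> is reserved for
  real normed vector spaces, which the \<open>p\<close>-adic numbers are not.
\<close>

lift_definition padic_norm :: "'p::prime_card padic \<Rightarrow> real" is
  "\<lambda>X. lim (\<lambda>n. padic_abs CARD('p) (X n))"
  by (rule padic_rel_lim_abs[OF prime_card])

lemma padic_cases_tendsto:
  fixes x :: "'p::prime_card padic"
  obtains X where "padic_cauchy CARD('p) X" "x = abs_padic X"
    "(\<lambda>n. padic_abs CARD('p) (X n)) \<longlonglongrightarrow> padic_norm x"
proof -
  obtain X where X: "padic_cauchy CARD('p) X" "x = abs_padic X"
    by (rule abs_padic_cases)
  have "padic_rel CARD('p) X X"
    using X by (simp add: padic_rel_def padic_null_const[OF prime_card])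
  then have "padic_norm x = lim (\<lambda>n. padic_abs CARD('p) (X n))"
    using X padic_norm.abs_eq by blast
  then show ?thesis
    using that[OF X] padic_cauchy_convergent_abs[OF prime_card X(1)]
    by (simp add: convergent_LIMSEQ_iff)
qed

lemma padic_norm_eqI:
  assumes "padic_cauchy CARD('p) X" "(\<lambda>n. padic_abs CARD('p) (X n)) \<longlonglongrightarrow> l"
  shows "padic_norm (abs_padic X :: 'p::prime_card padic) = l"
proof -
  have "padic_rel CARD('p) X X"
    using assms by (simp add: padic_rel_def padic_null_const[OF prime_card])
  then show ?thesis
    using assms padic_norm.abs_eq limI by blast
qed

lemma abs_padic_plus:
  "padic_cauchy CARD('p) X \<Longrightarrow> padic_cauchy CARD('p) Y \<Longrightarrow>
    abs_padic X + abs_padic Y = (abs_padic (\<lambda>n. X n + Y n) :: 'p::prime_card padic)"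
  by (rule plus_padic.abs_eq) (simp_all add: padic_rel_def padic_null_const[OF prime_card])

lemma abs_padic_times:
  "padic_cauchy CARD('p) X \<Longrightarrow> padic_cauchy CARD('p) Y \<Longrightarrow>
    abs_padic X * abs_padic Y = (abs_padic (\<lambda>n. X n * Y n) :: 'p::prime_card padic)"
  by (rule times_padic.abs_eq) (simp_all add: padic_rel_def padic_null_const[OF prime_card])

lemma padic_norm_nonneg: "0 \<le> padic_norm (x :: 'p::prime_card padic)"
  by (rule padic_cases_tendsto[of x], rule LIMSEQ_le_const) auto

lemma padic_norm_eq_0_iff: "padic_norm x = 0 \<longleftrightarrow> x = (0 :: 'p::prime_card padic)"
proof -
  note p = prime_card[where 'a='p]
  obtain X where X: "padic_cauchy CARD('p) X" "x = abs_padic X"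
    "(\<lambda>n. padic_abs CARD('p) (X n)) \<longlonglongrightarrow> padic_norm x"
    by (rule padic_cases_tendsto)
  have "x = 0 \<longleftrightarrow> padic_null CARD('p) X"
    using abs_padic_eq_iff[OF X(1) padic_cauchy_const[OF p]]
    unfolding X(2) zero_padic_def by simp
  also have "\<dots> \<longleftrightarrow> padic_norm x = 0"
    using X(3) LIMSEQ_unique by (auto simp: padic_null_def)
  finally show ?thesis by simp
qed

lemma padic_norm_mult: "padic_norm (x * y) = padic_norm x * padic_norm (y :: 'p::prime_card padic)"
proof -
  note p = prime_card[where 'a='p]
  obtain X where X: "padic_cauchy CARD('p) X" "x = abs_padic X"
    "(\<lambda>n. padic_abs CARD('p) (X n)) \<longlonglongrightarrow> padic_norm x"
    by (rule padic_cases_tendsto)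
  obtain Y where Y: "padic_cauchy CARD('p) Y" "y = abs_padic Y"
    "(\<lambda>n. padic_abs CARD('p) (Y n)) \<longlonglongrightarrow> padic_norm y"
    by (rule padic_cases_tendsto)
  show ?thesis
    unfolding X(2) Y(2) abs_padic_times[OF X(1) Y(1)]
    using tendsto_mult[OF X(3) Y(3)] X Y
    by (intro padic_norm_eqI padic_cauchy_mult[OF p]) (simp_all add: padic_abs_mult[OF p])
qed

lemma padic_norm_ultrametric: "padic_norm (x + y) \<le> max (padic_norm x) (padic_norm (y :: 'p::prime_card padic))"
proof -
  note p = prime_card[where 'a='p]
  obtain X where X: "padic_cauchy CARD('p) X" "x = abs_padic X"
    "(\<lambda>n. padic_abs CARD('p) (X n)) \<longlonglongrightarrow> padic_norm x"
    by (rule padic_cases_tendsto)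
  obtain Y where Y: "padic_cauchy CARD('p) Y" "y = abs_padic Y"
    "(\<lambda>n. padic_abs CARD('p) (Y n)) \<longlonglongrightarrow> padic_norm y"
    by (rule padic_cases_tendsto)
  obtain Z where Z: "(\<lambda>n. padic_abs CARD('p) (X n + Y n)) \<longlonglongrightarrow> Z"
    using padic_cauchy_convergent_abs[OF p padic_cauchy_add[OF p X(1) Y(1)]] convergent_def
    by blast
  have "padic_norm (x + y) = Z"
    unfolding X(2) Y(2) abs_padic_plus[OF X(1) Y(1)]
    using Z X Y by (intro padic_norm_eqI padic_cauchy_add[OF p])
  moreover have "Z \<le> max (padic_norm x) (padic_norm y)"
    using Z tendsto_max[OF X(3) Y(3)]
    by (rule LIMSEQ_le) (auto intro: padic_abs_ultrametric[OF p])
  ultimately show ?thesis by simp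
qed

lemma padic_norm_minus: "padic_norm (- x) = padic_norm (x :: 'p::prime_card padic)"
proof -
  note p = prime_card[where 'a='p]
  obtain X where X: "padic_cauchy CARD('p) X" "x = abs_padic X"
    "(\<lambda>n. padic_abs CARD('p) (X n)) \<longlonglongrightarrow> padic_norm x"
    by (rule padic_cases_tendsto)
  have "- x = abs_padic (\<lambda>n. - X n)"
    unfolding X(2)
    by (rule uminus_padic.abs_eq) (simp add: padic_rel_def X padic_null_const[OF p])
  then show ?thesis
    using X by (auto intro!: padic_norm_eqI padic_cauchy_minus[OF p] simp: padic_abs_minus[OF p])
qed

instantiation padic :: (prime_card) metric_space
begin

definition dist_padic :: "'a padic \<Rightarrow> 'a padic \<Rightarrow> real" where
  "dist_padic x y = padic_norm (x - y)"

definition uniformity_padic :: "('a padic \<times> 'a padic) filter" where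
  "uniformity_padic = (INF e\<in>{0<..}. principal {(x, y). dist x y < e})"

definition open_padic :: "'a padic set \<Rightarrow> bool" where
  "open_padic U \<longleftrightarrow> (\<forall>x\<in>U. eventually (\<lambda>(x', y). x' = x \<longrightarrow> y \<in> U) uniformity)"

instance
proof
  fix x y z :: "'a padic"
  show "dist x y = 0 \<longleftrightarrow> x = y"
    by (simp add: dist_padic_def padic_norm_eq_0_iff)
  have "dist x y \<le> max (padic_norm (x - z)) (padic_norm (z - y))"
    using padic_norm_ultrametric[of "x - z" "z - y"] by (simp add: dist_padic_def)
  also have "\<dots> \<le> padic_norm (x - z) + padic_norm (z - y)"
    by (simp add: padic_norm_nonneg)
  also have "padic_norm (z - y) = padic_norm (y - z)"
    using padic_norm_minus[of "z - y"] by simp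
  finally show "dist x y \<le> dist x z + dist y z"
    by (simp add: dist_padic_def)
qed (simp_all add: uniformity_padic_def open_padic_def)

end

lemma of_nat_padic: "of_nat k = (abs_padic (\<lambda>_. of_nat k) :: 'p::prime_card padic)"
  by (induction k)
     (simp_all add: zero_padic_def one_padic_def abs_padic_plus padic_cauchy_const[OF prime_card])

lemma padic_norm_of_nat: "padic_norm (of_nat k :: 'p::prime_card padic) = padic_abs CARD('p) (of_nat k)"
  unfolding of_nat_padic by (intro padic_norm_eqI padic_cauchy_const[OF prime_card] tendsto_const)

lemma padic_norm_prime: "padic_norm (of_nat CARD('p) :: 'p::prime_card padic) = inverse (real CARD('p))"
  unfolding padic_norm_of_nat by (rule padic_abs_p[OF prime_card])

text \<open>The \<open>p\<close>-adic integers are the closed unit ball of \<open>\<rat>\<^sub>p\<close>.\<close>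

definition Zp :: "'p::prime_card padic set" where
  "Zp = {x. padic_norm x \<le> 1}"

abbreviation Qp :: "'p::prime_card padic set" where
  "Qp \<equiv> UNIV"


section \<open>Dynamical notions on a subspace \<open>X\<close> of the \<open>p\<close>-adic numbers\<close>

text \<open>
  Self-maps of \<open>X\<close> are functions in \<open>X \<rightarrow> X\<close>; their values outside \<open>X\<close> are irrelevant.
  Suprema are extended reals, since they can be infinite on \<open>\<rat>\<^sub>p\<close>.
\<close>

definition sup_norm :: "'p::prime_card padic set \<Rightarrow> ('p padic \<Rightarrow> 'p padic) \<Rightarrow> ereal" where
  "sup_norm X \<phi> = (SUP x\<in>X. ereal (padic_norm (\<phi> x)))"

definition Lip :: "'p::prime_card padic set \<Rightarrow> ('p padic \<Rightarrow> 'p padic) \<Rightarrow> ereal" where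
  "Lip X \<phi> = (SUP (x, y)\<in>{(x, y). x \<in> X \<and> y \<in> X \<and> x \<noteq> y}.
      ereal (padic_norm (\<phi> x - \<phi> y) / padic_norm (x - y)))"

definition Lip_ball :: "real \<Rightarrow> 'p::prime_card padic set \<Rightarrow> ('p padic \<Rightarrow> 'p padic) set" where
  "Lip_ball \<delta> X = {\<phi> \<in> X \<rightarrow> X. Lip X \<phi> \<le> ereal \<delta> \<and> sup_norm X \<phi> \<le> ereal \<delta>}"

definition pseudo_orbit ::
    "'p::prime_card padic set \<Rightarrow> ('p padic \<Rightarrow> 'p padic) \<Rightarrow> real \<Rightarrow> (nat \<Rightarrow> 'p padic) \<Rightarrow> bool" where
  "pseudo_orbit X f \<delta> x \<longleftrightarrow> (\<forall>n. x n \<in> X) \<and> (\<forall>n. padic_norm (f (x n) - x (Suc n)) \<le> \<delta>)"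

definition shadowing :: "'p::prime_card padic set \<Rightarrow> ('p padic \<Rightarrow> 'p padic) \<Rightarrow> bool" where
  "shadowing X f \<longleftrightarrow>
     (\<forall>\<epsilon>>0. \<exists>\<delta>>0. \<forall>x. pseudo_orbit X f \<delta> x \<longrightarrow>
        (\<exists>z\<in>X. \<forall>n. padic_norm (x n - (f ^^ n) z) \<le> \<epsilon>))"

definition lipschitz_structurally_stable ::
    "'p::prime_card padic set \<Rightarrow> ('p padic \<Rightarrow> 'p padic) \<Rightarrow> bool" where
  "lipschitz_structurally_stable X f \<longleftrightarrow>
     (\<exists>\<delta>>0. \<forall>\<phi>\<in>Lip_ball \<delta> X. \<exists>h k. homeomorphism X X h k \<and>
        (\<forall>x\<in>X. f (h x) = h (f x + \<phi> x)))"

definition topologically_stable :: "'p::prime_card padic set \<Rightarrow> ('p padic \<Rightarrow> 'p padic) \<Rightarrow> bool" where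
  "topologically_stable X f \<longleftrightarrow>
     (\<forall>\<epsilon>>0. \<exists>\<delta>>0. \<forall>g. continuous_on X g \<and> g \<in> X \<rightarrow> X \<and> sup_norm X (\<lambda>x. f x - g x) \<le> ereal \<delta> \<longrightarrow>
        (\<exists>h. continuous_on X h \<and> h \<in> X \<rightarrow> X \<and> sup_norm X (\<lambda>x. h x - x) \<le> ereal \<epsilon> \<and>
          (\<forall>x\<in>X. f (h x) = h (g x))))"

end

theory Submission
  imports Defs
begin

text \<open>
  Let \<open>R\<close> be multiplication by \<open>p\<^sup>2\<close> on \<open>\<int>\<^sub>p\<close> and by \<open>p\<close> elsewhere, and let \<open>f\<close> invert \<open>R\<close> on
  its image and vanish off it. Where it does not vanish, \<open>f\<close> expands the norm by at least \<open>p\<close>, so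
  \<open>0\<close> is its only periodic point. The image of \<open>R\<close> misses the sphere of radius \<open>1/p\<close>, which \<open>f\<close>
  therefore sends to \<open>0\<close>. Let \<open>g\<close> be \<open>f\<close> with the value on that sphere changed to the small
  number \<open>p\<^bsup>2N+1\<^esup>\<close>; then \<open>p \<mapsto> p\<^bsup>2N+1\<^esup> \<mapsto> p\<^bsup>2N-1\<^esup> \<mapsto> \<dots> \<mapsto> p\<close> is a cycle of \<open>g\<close>. It is a
  pseudo-orbit of \<open>f\<close> which cannot be shadowed, and every \<open>h\<close> with \<open>f \<circ> h = h \<circ> g\<close> sends the
  whole cycle to \<open>0\<close>, so that \<open>h\<close> is neither injective nor close to the identity.
\<close>

section \<open>Ultrametric arithmetic of the \<open>p\<close>-adic norm\<close>

lemma padic_norm_0 [simp]: "padic_norm (0 :: 'p::prime_card padic) = 0"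
  by (simp add: padic_norm_eq_0_iff)

lemma padic_norm_1 [simp]: "padic_norm (1 :: 'p::prime_card padic) = 1"
  using padic_norm_of_nat[of 1, where 'p='p] padic_abs_1[OF prime_card[where 'a='p]] by simp

lemma padic_norm_power: "padic_norm (x ^ n) = padic_norm (x :: 'p::prime_card padic) ^ n"
  by (induction n) (simp_all add: padic_norm_mult)

lemma padic_norm_divide:
  "padic_norm (x / y) = padic_norm x / padic_norm (y :: 'p::prime_card padic)"
proof (cases "y = 0")
  case False
  then have "padic_norm (x / y) * padic_norm y = padic_norm x"
    by (simp flip: padic_norm_mult)
  then show ?thesis
    using False by (simp add: padic_norm_eq_0_iff field_simps)
qed simp

lemma padic_norm_minus_commute:
  "padic_norm (x - y) = padic_norm (y - x :: 'p::prime_card padic)"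
  using padic_norm_minus[of "x - y"] by simp

lemma padic_norm_diff_le:
  "padic_norm (x - y) \<le> max (padic_norm x) (padic_norm (y :: 'p::prime_card padic))"
  using padic_norm_ultrametric[of x "- y"] by (simp add: padic_norm_minus)

text \<open>Isosceles triangle principle: \<open>x\<close>, \<open>y\<close> and
  \<open>x - y\<close> are each bounded by the maximum of the other two, so the two largest norms
  among the three agree.\<close>

lemma padic_norm_diff_eq_max:
  fixes x y :: "'p::prime_card padic"
  assumes "padic_norm x \<noteq> padic_norm y"
  shows "padic_norm (x - y) = max (padic_norm x) (padic_norm y)"
  using assms padic_norm_diff_le[of x y] padic_norm_ultrametric[of "x - y" y]
    padic_norm_diff_le[of x "x - y"]
  by simp

text \<open>Were the norms different, the isosceles principle would give \<open>x - y\<close> at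
  least the norm of \<open>x\<close>. Hence spheres about 0 are open.\<close>

lemma padic_norm_eq_of_close:
  fixes x y :: "'p::prime_card padic"
  assumes "padic_norm (x - y) < padic_norm x"
  shows "padic_norm y = padic_norm x"
  using assms padic_norm_diff_eq_max[of x y] by (cases "padic_norm x = padic_norm y") auto

lemma Zp_zero [simp]: "0 \<in> Zp"
  by (simp add: Zp_def)

section \<open>Criteria for continuity and for Lipschitz bounds\<close>

lemma padic_continuous_onI:
  fixes f :: "'p::prime_card padic \<Rightarrow> 'p padic"
  assumes "r > 0"
    and "\<And>x y. x \<in> X \<Longrightarrow> y \<in> X \<Longrightarrow> padic_norm (x - y) \<le> r \<Longrightarrow>
           padic_norm (f x - f y) \<le> C * padic_norm (x - y)"
  shows "continuous_on X f"
  unfolding continuous_on_iff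
proof (intro ballI allI impI)
  fix x and e :: real
  assume x: "x \<in> X" and e: "e > 0"
  \<comment> \<open>The denominator \<open>\<bar>C\<bar> + 1\<close> is positive whatever the sign
    of \<open>C\<close>.\<close>
  define d where "d = min r (e / (\<bar>C\<bar> + 1))"
  have "dist (f y) (f x) < e" if y: "y \<in> X" "dist y x < d" for y
  proof -
    have "padic_norm (f y - f x) \<le> C * padic_norm (y - x)"
      using assms(2)[OF y(1) x] y(2) by (simp add: d_def dist_padic_def)
    also have "\<dots> \<le> (\<bar>C\<bar> + 1) * padic_norm (y - x)"
      by (intro mult_right_mono) (auto simp: padic_norm_nonneg)
    also have "\<dots> < e"
      using y(2) by (simp add: d_def dist_padic_def field_simps)
    finally show ?thesis by (simp add: dist_padic_def)
  qed
  moreover have "d > 0" using assms(1) e by (simp add: d_def)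
  ultimately show "\<exists>d>0. \<forall>y\<in>X. dist y x < d \<longrightarrow> dist (f y) (f x) < e" by blast
qed

lemma Lip_leI:
  assumes "\<And>x y. x \<in> X \<Longrightarrow> y \<in> X \<Longrightarrow> padic_norm (\<phi> x - \<phi> y) \<le> C * padic_norm (x - y)"
  shows "Lip X \<phi> \<le> ereal C"
  unfolding Lip_def
proof (rule SUP_least, clarify)
  fix x y assume "x \<in> X" "y \<in> X" "x \<noteq> y"
  moreover from this have "padic_norm (x - y) > 0"
    using padic_norm_nonneg[of "x - y"] padic_norm_eq_0_iff[of "x - y"] by auto
  ultimately show "ereal (padic_norm (\<phi> x - \<phi> y) / padic_norm (x - y)) \<le> ereal C"
    using assms by (simp add: divide_le_eq)
qed

section \<open>The contraction, its left inverse and the perturbation\<close>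

abbreviation unif :: "'p::prime_card padic" where
  "unif \<equiv> of_nat CARD('p)"

lemma card_ge_2: "real CARD('p::prime_card) \<ge> 2"
  using prime_ge_2_nat[OF prime_card[where 'a='p]] by simp

lemma unif_neq_0: "(unif :: 'p::prime_card padic) \<noteq> 0"
  using padic_norm_prime[where 'p='p] card_ge_2[where 'p='p] by (metis inverse_zero_imp_zero
      not_numeral_le_zero padic_norm_0)

lemma padic_norm_divide_unif:
  "padic_norm (x / unif) = real CARD('p) * padic_norm (x :: 'p::prime_card padic)"
  by (simp add: padic_norm_divide padic_norm_prime field_simps)

lemma padic_norm_divide_unif_sq:
  "padic_norm (x / unif ^ 2) = real CARD('p) ^ 2 * padic_norm (x :: 'p::prime_card padic)"
  by (simp add: padic_norm_divide padic_norm_power padic_norm_prime field_simps)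

lemma unif_power_Zp: "(unif ^ n :: 'p::prime_card padic) \<in> Zp"
  using card_ge_2[where 'p='p]
  by (simp add: Zp_def padic_norm_power padic_norm_prime power_le_one inverse_le_1_iff)

definition contr :: "'p::prime_card padic \<Rightarrow> 'p padic" where
  "contr x = (if x \<in> Zp then unif ^ 2 * x else unif * x)"

text \<open>The set \<open>X - Zp\<close> serves both spaces at once: it is empty for
  \<open>X = Zp\<close>, which removes the second branch, and it is the complement of
  \<open>Zp\<close> for \<open>X = Qp\<close>.\<close>

definition expand :: "'p::prime_card padic set \<Rightarrow> 'p padic \<Rightarrow> 'p padic" where
  "expand X w = (if w / unif ^ 2 \<in> Zp then w / unif ^ 2
                 else if w / unif \<in> X - Zp then w / unif else 0)"

text \<open>The exponent is odd so that repeated division by \<open>unif ^ 2\<close> ends at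
  \<open>unif\<close>, which lies on the sphere where \<open>bump\<close> acts.\<close>

definition bump :: "nat \<Rightarrow> 'p::prime_card padic \<Rightarrow> 'p padic" where
  "bump N w = (if padic_norm w = inverse (real CARD('p)) then unif ^ (2 * N + 1) else 0)"

lemma contr_lipschitz:
  fixes x y :: "'p::prime_card padic"
  shows "padic_norm (contr x - contr y) \<le> inverse (real CARD('p)) * padic_norm (x - y)"
proof -
  let ?i = "inverse (real CARD('p))"
  have i: "0 < ?i" "?i < 1" using card_ge_2[where 'p='p] by (auto simp: field_simps)
  then have i2: "?i ^ 2 \<le> ?i" by (simp add: power2_eq_square)
  \<comment> \<open>Across the two branches the isosceles principle gives \<open>a - b\<close> the
    norm of \<open>b\<close>, and this dominates both images up to the factor
    \<open>1/p\<close>.\<close>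
  have mixed: "padic_norm (unif ^ 2 * a - unif * b) \<le> ?i * padic_norm (a - b)"
    if "a \<in> Zp" "b \<notin> Zp" for a b :: "'p padic"
  proof -
    have ab: "padic_norm a < padic_norm b" using that by (simp add: Zp_def)
    have "?i\<^sup>2 * padic_norm a \<le> ?i * padic_norm b"
      using i i2 ab by (intro mult_mono) (auto simp: padic_norm_nonneg)
    then have "padic_norm (unif ^ 2 * a - unif * b) \<le> ?i * padic_norm b"
      using padic_norm_diff_le[of "unif ^ 2 * a" "unif * b"]
      by (simp add: padic_norm_mult padic_norm_power padic_norm_prime)
    then show ?thesis
      using padic_norm_diff_eq_max[of a b] ab by simp
  qed
  consider "x \<in> Zp" "y \<in> Zp" | "x \<notin> Zp" "y \<notin> Zp" | "x \<in> Zp" "y \<notin> Zp" | "x \<notin> Zp" "y \<in> Zp"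
    by blast
  then show ?thesis
  proof cases
    case 1
    then have "padic_norm (contr x - contr y) = ?i ^ 2 * padic_norm (x - y)"
      by (simp add: contr_def padic_norm_mult padic_norm_power padic_norm_prime
          flip: right_diff_distrib)
    then show ?thesis
      using mult_right_mono[OF i2 padic_norm_nonneg[of "x - y"]] by simp
  next
    case 2
    then show ?thesis
      by (simp add: contr_def padic_norm_mult padic_norm_prime flip: right_diff_distrib)
  next
    case 3
    then show ?thesis using mixed by (simp add: contr_def)
  next
    case 4
    then show ?thesis using mixed[of y x] padic_norm_minus_commute[of x y]
        padic_norm_minus_commute[of "contr x" "contr y"] by (simp add: contr_def)
  qed
qed

section \<open>Orbits of the expanding map\<close>

lemma expand_0 [simp]: "expand X 0 = 0"
  by (simp add: expand_def)

lemma expand_funpow_0 [simp]: "(expand X ^^ n) 0 = 0"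
  by (induction n) simp_all

lemma expand_contr:
  fixes x :: "'p::prime_card padic"
  assumes "x \<in> X"
  shows "expand X (contr x) = x"
proof (cases "x \<in> Zp")
  case True
  then show ?thesis by (simp add: contr_def expand_def unif_neq_0)
next
  case False
  \<comment> \<open>The first test in \<open>expand\<close> is applied to
    \<open>contr x / unif ^ 2 = x / unif\<close>. It fails because division by \<open>unif\<close>
    only enlarges the norm.\<close>
  have "1 * padic_norm x \<le> real CARD('p) * padic_norm x"
    using card_ge_2[where 'p='p] by (intro mult_right_mono) (auto simp: padic_norm_nonneg)
  then have "x / unif \<notin> Zp"
    using False unfolding Zp_def mem_Collect_eq padic_norm_divide_unif by linarith
  moreover have "unif * x / unif ^ 2 = x / unif"
    by (simp add: power2_eq_square unif_neq_0)
  ultimately show ?thesis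
    using False assms by (simp add: contr_def expand_def unif_neq_0)
qed

text \<open>Both tests fail: \<open>w / unif ^ 2\<close> has norm \<open>p > 1\<close>, while
  \<open>w / unif\<close> has norm exactly 1 and so lies in \<open>Zp\<close>.\<close>

lemma expand_sphere:
  assumes "padic_norm (w :: 'p::prime_card padic) = inverse (real CARD('p))"
  shows "expand X w = 0"
  using assms card_ge_2[where 'p='p]
  by (simp add: expand_def Zp_def padic_norm_divide_unif padic_norm_divide_unif_sq)
    (simp add: power2_eq_square mult.assoc)

lemma expand_unif_power:
  "expand X (unif ^ (n + 2)) = (unif ^ n :: 'p::prime_card padic)"
proof -
  have "unif ^ (n + 2) / unif ^ 2 = (unif ^ n :: 'p padic)"
    by (simp only: power_add) (simp add: unif_neq_0)
  then show ?thesis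
    by (simp add: expand_def unif_power_Zp del: power_Suc add_2_eq_Suc')
qed

lemma expand_eq_0_or_norm_ge:
  fixes w :: "'p::prime_card padic"
  shows "expand X w = 0 \<or> padic_norm (expand X w) \<ge> real CARD('p) * padic_norm w"
proof -
  have "real CARD('p) \<le> real CARD('p) ^ 2"
    using card_ge_2[where 'p='p] by (simp add: power2_eq_square)
  then have "real CARD('p) * padic_norm w \<le> real CARD('p) ^ 2 * padic_norm w"
    by (intro mult_right_mono) (auto simp: padic_norm_nonneg)
  then show ?thesis
    by (simp add: expand_def padic_norm_divide_unif padic_norm_divide_unif_sq)
qed

text \<open>Each step either reaches the fixed point 0 or multiplies the norm by at least
  \<open>p\<close>. A return to \<open>z\<close> after \<open>Suc n\<close> steps therefore forces
  \<open>z = 0\<close> or \<open>p ^ Suc n * padic_norm z \<le> padic_norm z\<close>.\<close>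

lemma expand_periodic_eq_0:
  fixes z :: "'p::prime_card padic"
  assumes "(expand X ^^ Suc n) z = z"
  shows "z = 0"
proof -
  have "(expand X ^^ k) z = 0 \<or> padic_norm ((expand X ^^ k) z) \<ge> real CARD('p) ^ k * padic_norm z" for k
  proof (induction k)
    case (Suc k)
    show ?case
    proof (cases "(expand X ^^ k) z = 0")
      case False
      then have "real CARD('p) * (real CARD('p) ^ k * padic_norm z)
          \<le> real CARD('p) * padic_norm ((expand X ^^ k) z)"
        using Suc by (intro mult_left_mono) auto
      then show ?thesis
        using expand_eq_0_or_norm_ge[of X "(expand X ^^ k) z"]
        by (simp only: funpow.simps o_apply power_Suc mult.assoc) linarith
    qed simp
  qed simp
  from this[of "Suc n"] have "z = 0 \<or> real CARD('p) ^ Suc n * padic_norm z \<le> 1 * padic_norm z"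
    by (simp only: assms mult_1)
  moreover have "real CARD('p) ^ Suc n > 1"
    using card_ge_2[where 'p='p] by (intro one_less_power) auto
  ultimately show ?thesis
    using padic_norm_nonneg[of z] padic_norm_eq_0_iff[of z]
    by (auto simp only: mult_le_cancel_right)
qed

section \<open>The maps on \<open>X\<close>, for \<open>X\<close> equal to \<open>Zp\<close> or
  \<open>Qp\<close>\<close>

context
  fixes X :: "'p::prime_card padic set"
  assumes X: "X \<in> {Zp, Qp}"
begin

text \<open>Both spaces are unions of spheres about 0. This makes the second test of
  \<open>expand\<close> depend on the norm alone.\<close>

lemma mem_iff_of_norm_eq: "padic_norm x = padic_norm y \<Longrightarrow> x \<in> X \<longleftrightarrow> y \<in> X"
  using X by (auto simp: Zp_def)

lemma add_mem: "x \<in> X \<Longrightarrow> y \<in> X \<Longrightarrow> x + y \<in> X"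
  using X padic_norm_ultrametric[of x y] by (auto simp: Zp_def)

lemma unif_power_mem: "unif ^ n \<in> X"
  using X unif_power_Zp[of n] by auto

lemma contr_mem: "x \<in> X \<Longrightarrow> contr x \<in> X"
proof -
  have "padic_norm (unif ^ 2 * x) \<le> 1" if "padic_norm x \<le> 1" for x :: "'p padic"
    using that card_ge_2[where 'p='p] padic_norm_nonneg[of x]
    by (simp add: padic_norm_mult padic_norm_power padic_norm_prime power_le_one mult_le_one
        inverse_le_1_iff)
  then show "x \<in> X \<Longrightarrow> contr x \<in> X"
    using X by (auto simp: Zp_def contr_def)
qed

lemma expand_mem: "expand X w \<in> X"
  using X by (auto simp: expand_def)

lemma bump_mem: "bump N w \<in> X"
  using unif_power_mem[of "2 * N + 1"] unif_power_mem[of 0] X by (auto simp: bump_def)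

text \<open>The first branch of \<open>expand\<close> lives on the ball of radius
  \<open>p^(-2)\<close>. Two points at most that far apart lie either both in this ball or on a
  common sphere outside it, so the same branch applies to both.\<close>

lemma expand_local_lipschitz:
  fixes x y :: "'p padic"
  assumes "padic_norm (x - y) \<le> inverse (real CARD('p)) ^ 2"
  shows "padic_norm (expand X x - expand X y) \<le> real CARD('p) ^ 2 * padic_norm (x - y)"
proof -
  let ?P = "real CARD('p)"
  have scale: "a / unif ^ 2 \<in> Zp \<longleftrightarrow> padic_norm a \<le> inverse ?P ^ 2" for a :: "'p padic"
    using card_ge_2[where 'p='p]
    by (simp add: Zp_def padic_norm_divide_unif_sq field_simps)
  have P: "?P \<le> ?P ^ 2" using card_ge_2[where 'p='p] by (simp add: power2_eq_square)
  show ?thesis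
  proof (cases "padic_norm x \<le> inverse ?P ^ 2")
    case True
    then have "padic_norm y \<le> inverse ?P ^ 2"
      using assms padic_norm_diff_le[of x "x - y"] by simp
    then show ?thesis
      using True
      by (simp add: expand_def scale padic_norm_divide_unif_sq flip: diff_divide_distrib)
  next
    case False
    then have eq: "padic_norm x = padic_norm y"
      using assms padic_norm_eq_of_close[of x y] by simp
    then have "padic_norm (x / unif) = padic_norm (y / unif)"
      by (simp add: padic_norm_divide)
    then have "x / unif \<in> X - Zp \<longleftrightarrow> y / unif \<in> X - Zp"
      using mem_iff_of_norm_eq[of "x / unif" "y / unif"] by (simp add: Zp_def)
    moreover have "expand X x = (if x / unif \<in> X - Zp then x / unif else 0)"
      by (simp only: expand_def scale False if_False)
    moreover have "expand X y = (if y / unif \<in> X - Zp then y / unif else 0)"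
      by (simp only: expand_def scale False[unfolded eq] if_False)
    moreover have "padic_norm (x / unif - y / unif) \<le> ?P ^ 2 * padic_norm (x - y)"
      using mult_right_mono[OF P padic_norm_nonneg[of "x - y"]]
      by (simp add: padic_norm_divide_unif flip: diff_divide_distrib)
    ultimately show ?thesis
      by (cases "y / unif \<in> X - Zp") (simp_all only: if_True if_False diff_self padic_norm_0
          mult_nonneg_nonneg zero_le_power2 padic_norm_nonneg)
  qed
qed

lemma expand_continuous: "continuous_on X (expand X)"
  using card_ge_2[where 'p='p]
  by (intro padic_continuous_onI[OF _ expand_local_lipschitz]) auto

text \<open>The value changes only between the sphere of radius \<open>1/p\<close> and its
  complement, whose points are at least \<open>1/p\<close> apart; the jump has norm
  \<open>p^(-(2N+1))\<close>.\<close>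

lemma bump_lipschitz:
  fixes x y :: "'p padic"
  shows "padic_norm (bump N x - bump N y) \<le> inverse (real CARD('p)) ^ (2 * N) * padic_norm (x - y)"
proof (cases "bump N x = bump N y")
  case True
  then show ?thesis by (simp add: padic_norm_nonneg)
next
  case False
  let ?i = "inverse (real CARD('p))"
  have "padic_norm (bump N x - bump N y) = ?i ^ (2 * N) * ?i"
    using False by (auto simp: bump_def padic_norm_minus padic_norm_mult padic_norm_power
        padic_norm_prime split: if_splits)
  moreover have "padic_norm (x - y) \<ge> ?i"
    using False padic_norm_diff_eq_max[of x y] by (auto simp: bump_def split: if_splits)
  ultimately show ?thesis
    by (simp add: mult_left_mono)
qed

lemma bump_norm_le: "padic_norm (bump N (x :: 'p padic)) \<le> inverse (real CARD('p)) ^ (2 * N)"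
  using card_ge_2[where 'p='p]
  by (auto simp: bump_def padic_norm_mult padic_norm_power padic_norm_prime inverse_le_1_iff
      intro!: mult_left_le_one_le)

lemma bump_Lip_ball:
  assumes "inverse (real CARD('p)) ^ (2 * N) \<le> \<delta>"
  shows "bump N \<in> Lip_ball \<delta> X"
proof -
  have "Lip X (bump N) \<le> ereal (inverse (real CARD('p)) ^ (2 * N))"
    by (intro Lip_leI bump_lipschitz)
  moreover have "sup_norm X (bump N) \<le> ereal (inverse (real CARD('p)) ^ (2 * N))"
    unfolding sup_norm_def by (intro SUP_least) (simp add: bump_norm_le)
  ultimately show ?thesis
    using assms bump_mem unfolding Lip_ball_def
    by (auto intro: order_trans)
qed

section \<open>The perturbed map and its cycle\<close>

definition perturbed :: "nat \<Rightarrow> 'p padic \<Rightarrow> 'p padic" where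
  "perturbed N w = expand X w + bump N w"

lemma perturbed_mem: "perturbed N w \<in> X"
  by (simp add: perturbed_def add_mem expand_mem bump_mem)

lemma perturbed_continuous: "continuous_on X (perturbed N)"
proof -
  let ?i = "inverse (real CARD('p)) :: real"
  have i: "?i > 0" using card_ge_2[where 'p='p] by simp
  have "padic_norm (perturbed N x - perturbed N y) \<le> (real CARD('p) ^ 2 + ?i ^ (2 * N)) * padic_norm (x - y)"
    if "padic_norm (x - y) \<le> ?i ^ 2" for x y
  proof -
    have "perturbed N x - perturbed N y = (expand X x - expand X y) + (bump N x - bump N y)"
      by (simp add: perturbed_def)
    note eq = arg_cong[OF this, of padic_norm]
    have "padic_norm (perturbed N x - perturbed N y)
        \<le> padic_norm (expand X x - expand X y) + padic_norm (bump N x - bump N y)"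
      using eq padic_norm_ultrametric[of "expand X x - expand X y" "bump N x - bump N y"]
        padic_norm_nonneg[of "expand X x - expand X y"] padic_norm_nonneg[of "bump N x - bump N y"]
      by linarith
    then show ?thesis
      using expand_local_lipschitz[OF that] bump_lipschitz[of N x y]
      unfolding distrib_right by linarith
  qed
  then show ?thesis
    using i by (intro padic_continuous_onI[of "?i ^ 2"]) auto
qed

lemma perturbed_unif: "perturbed N unif = unif ^ (2 * N + 1)"
  by (simp add: perturbed_def expand_sphere bump_def padic_norm_prime)

lemma perturbed_unif_power: "perturbed N (unif ^ (2 * k + 3)) = unif ^ (2 * k + 1)"
proof -
  \<comment> \<open>The point lies strictly inside the sphere of radius \<open>1/p\<close>, so only
    \<open>expand\<close> acts on it.\<close>
  have "inverse (real CARD('p)) ^ (2 * k + 3) < inverse (real CARD('p)) ^ 1"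
    using card_ge_2[where 'p='p] by (intro power_strict_decreasing) (auto simp: field_simps)
  then have "bump N (unif ^ (2 * k + 3) :: 'p padic) = 0"
    by (simp add: bump_def padic_norm_power padic_norm_prime)
  then show ?thesis
    using expand_unif_power[of X "2 * k + 1"] by (simp add: perturbed_def numeral_3_eq_3)
qed

text \<open>One step takes \<open>unif\<close> to \<open>unif ^ (2 * N + 1)\<close>, and
  \<open>N\<close> divisions by \<open>unif ^ 2\<close> lead back, so the cycle closes after
  \<open>N + 1\<close> steps.\<close>

lemma perturbed_cycle: "(perturbed N ^^ Suc N) unif = unif"
proof -
  have "(perturbed N ^^ k) (unif ^ (2 * k + 1)) = unif" for k
  proof (induction k)
    case (Suc k)
    have "(perturbed N ^^ Suc k) (unif ^ (2 * Suc k + 1))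
        = (perturbed N ^^ k) (perturbed N (unif ^ (2 * k + 3)))"
      by (simp only: funpow_Suc_right o_apply) (simp add: numeral_3_eq_3)
    then show ?case
      using Suc by (simp only: perturbed_unif_power)
  qed simp
  then show ?thesis
    by (simp only: funpow_Suc_right o_apply perturbed_unif)
qed

text \<open>Iterating the relation shows that \<open>h unif\<close> is periodic under
  \<open>expand X\<close>, hence 0. One more application carries this to the next point of the
  cycle.\<close>

lemma semiconj_collapse:
  assumes "\<forall>x\<in>X. expand X (h x) = h (perturbed N x)"
  shows "h unif = 0" "h (unif ^ (2 * N + 1)) = 0"
proof -
  have u: "unif \<in> X" using unif_power_mem[of 1] by simp
  have "(perturbed N ^^ n) unif \<in> X \<and> (expand X ^^ n) (h unif) = h ((perturbed N ^^ n) unif)" for n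
    by (induction n) (use assms u perturbed_mem in auto)
  from this[of "Suc N"] have "(expand X ^^ Suc N) (h unif) = h unif"
    by (simp only: perturbed_cycle)
  then show 0: "h unif = 0"
    by (rule expand_periodic_eq_0)
  show "h (unif ^ (2 * N + 1)) = 0"
    using assms[rule_format, OF u] by (simp only: perturbed_unif 0 expand_0)
qed

section \<open>Failure of the three stability properties\<close>

lemma small_power:
  assumes "\<delta> > 0"
  obtains N where "N > 0" "inverse (real CARD('p)) ^ (2 * N) \<le> \<delta>"
proof -
  let ?i = "inverse (real CARD('p)) :: real"
  have i: "0 < ?i" "?i < 1" using card_ge_2[where 'p='p] by (auto simp: field_simps)
  obtain n where n: "?i ^ n < \<delta>"
    using real_arch_pow_inv[OF assms i(2)] by blast
  have "?i ^ (2 * Suc n) \<le> ?i ^ n"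
    using i by (intro power_decreasing) auto
  \<comment> \<open>Taking \<open>Suc n\<close> ensures \<open>N > 0\<close>, which makes
    \<open>unif\<close> and \<open>unif ^ (2 * N + 1)\<close> distinct.\<close>
  then show ?thesis using n that[of "Suc n"] by simp
qed

text \<open>This justifies \<open>p^(-2)\<close> as the tolerance below: a point that close to
  \<open>unif\<close> has the same norm as \<open>unif\<close>, and in particular is not 0.\<close>

lemma unif_norm_gt: "padic_norm (unif :: 'p padic) > inverse (real CARD('p)) ^ 2"
  using card_ge_2[where 'p='p] by (simp add: padic_norm_prime power2_eq_square field_simps)

lemma not_shadowing: "\<not> shadowing X (expand X)"
proof
  let ?e = "inverse (real CARD('p)) ^ 2"
  assume "shadowing X (expand X)"
  moreover have "?e > 0" using card_ge_2[where 'p='p] by simp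
  ultimately obtain \<delta> where d: "\<delta> > 0" and
    sh: "\<And>x. pseudo_orbit X (expand X) \<delta> x \<Longrightarrow>
      \<exists>z\<in>X. \<forall>n. padic_norm (x n - (expand X ^^ n) z) \<le> ?e"
    unfolding shadowing_def by meson
  obtain N where N: "inverse (real CARD('p)) ^ (2 * N) \<le> \<delta>"
    using small_power[OF d] by blast
  have "(perturbed N ^^ n) unif \<in> X" for n
    using unif_power_mem[of 1] by (cases n) (auto simp: perturbed_mem)
  moreover have "padic_norm (expand X x - perturbed N x) \<le> \<delta>" for x
    using bump_norm_le[of N x] N by (simp add: perturbed_def padic_norm_minus)
  ultimately have "pseudo_orbit X (expand X) \<delta> (\<lambda>n. (perturbed N ^^ n) unif)"
    by (simp add: pseudo_orbit_def)
  then obtain z where z: "\<And>n. padic_norm ((perturbed N ^^ n) unif - (expand X ^^ n) z) \<le> ?e"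
    using sh by blast
  \<comment> \<open>Shadowing at time 0 puts \<open>z\<close> on the sphere of radius
    \<open>1/p\<close>, so its true orbit is at 0 from time 1 on.\<close>
  have "padic_norm z = padic_norm (unif :: 'p padic)"
    using z[of 0] unif_norm_gt by (intro padic_norm_eq_of_close) simp
  then have "expand X z = 0"
    by (intro expand_sphere) (simp add: padic_norm_prime)
  then have "(expand X ^^ Suc N) z = 0"
    by (simp only: funpow_Suc_right o_apply expand_funpow_0)
  \<comment> \<open>At time \<open>Suc N\<close> the pseudo-orbit is back at \<open>unif\<close>,
    farther from 0 than the tolerance.\<close>
  then show False
    using z[of "Suc N"] unif_norm_gt by (simp only: perturbed_cycle) simp
qed

lemma not_lipschitz_structurally_stable: "\<not> lipschitz_structurally_stable X (expand X)"
proof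
  assume "lipschitz_structurally_stable X (expand X)"
  then obtain \<delta> where d: "\<delta> > 0" and
    st: "\<And>\<phi>. \<phi> \<in> Lip_ball \<delta> X \<Longrightarrow> \<exists>h k. homeomorphism X X h k \<and>
        (\<forall>x\<in>X. expand X (h x) = h (expand X x + \<phi> x))"
    unfolding lipschitz_structurally_stable_def by blast
  obtain N where N: "N > 0" "inverse (real CARD('p)) ^ (2 * N) \<le> \<delta>"
    using small_power[OF d] by blast
  obtain h k where hk: "homeomorphism X X h k"
    and h: "\<forall>x\<in>X. expand X (h x) = h (perturbed N x)"
    using st[OF bump_Lip_ball[OF N(2)]] by (auto simp: perturbed_def)
  have "unif = k (h unif)" "k (h (unif ^ (2 * N + 1))) = unif ^ (2 * N + 1)"
    using unif_power_mem[of 1] unif_power_mem[of "2 * N + 1"] homeomorphism_apply1[OF hk]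
    by simp_all
  \<comment> \<open>The map \<open>h\<close> sends both points to 0, and its inverse
    \<open>k\<close> then identifies them; comparing their norms gives the contradiction.\<close>
  then have eq: "(unif :: 'p padic) = unif ^ (2 * N + 1)"
    using semiconj_collapse[OF h] by simp
  have "inverse (real CARD('p)) ^ (2 * N + 1) < inverse (real CARD('p)) ^ 1"
    using card_ge_2[where 'p='p] N by (intro power_strict_decreasing) (auto simp: field_simps)
  moreover have "padic_norm (unif :: 'p padic) = inverse (real CARD('p)) ^ (2 * N + 1)"
    by (subst eq) (simp only: padic_norm_power padic_norm_prime)
  ultimately show False
    by (simp only: padic_norm_prime power_one_right)
qed

lemma not_topologically_stable: "\<not> topologically_stable X (expand X)"
proof
  let ?e = "inverse (real CARD('p)) ^ 2"
  assume "topologically_stable X (expand X)"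
  moreover have "?e > 0" using card_ge_2[where 'p='p] by simp
  ultimately obtain \<delta> where d: "\<delta> > 0" and
    st: "\<And>g. continuous_on X g \<Longrightarrow> g \<in> X \<rightarrow> X \<Longrightarrow>
        sup_norm X (\<lambda>x. expand X x - g x) \<le> ereal \<delta> \<Longrightarrow>
        \<exists>h. sup_norm X (\<lambda>x. h x - x) \<le> ereal ?e \<and> (\<forall>x\<in>X. expand X (h x) = h (g x))"
    unfolding topologically_stable_def by meson
  obtain N where N: "inverse (real CARD('p)) ^ (2 * N) \<le> \<delta>"
    using small_power[OF d] by blast
  have "padic_norm (expand X x - perturbed N x) \<le> \<delta>" for x
    using bump_norm_le[of N x] N by (simp add: perturbed_def padic_norm_minus)
  then have "sup_norm X (\<lambda>x. expand X x - perturbed N x) \<le> ereal \<delta>"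
    unfolding sup_norm_def by (intro SUP_least) simp
  then obtain h where e: "sup_norm X (\<lambda>x. h x - x) \<le> ereal ?e"
    and h: "\<forall>x\<in>X. expand X (h x) = h (perturbed N x)"
    using st[of "perturbed N"] perturbed_continuous perturbed_mem by auto
  have "ereal (padic_norm (h unif - unif)) \<le> sup_norm X (\<lambda>x. h x - x)"
    unfolding sup_norm_def using unif_power_mem[of 1] by (intro SUP_upper) simp
  then have "ereal (padic_norm (h unif - unif)) \<le> ereal ?e"
    using e by (rule order_trans)
  \<comment> \<open>Since \<open>h unif = 0\<close>, the displacement of \<open>unif\<close> under
    \<open>h\<close> has the norm of \<open>unif\<close> itself.\<close>
  then show False
    using semiconj_collapse(1)[OF h] unif_norm_gt by (simp add: padic_norm_minus)
qed

end

theorem theorem2: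
  fixes X :: "'p::prime_card padic set"
  assumes "X \<in> {Zp, Qp}"
  shows "\<exists>f. continuous_on X f \<and> f \<in> X \<rightarrow> X \<and>
           (\<exists>R. R \<in> X \<rightarrow> X \<and> Lip X R < 1 \<and> (\<forall>x\<in>X. f (R x) = x)) \<and>
           \<not> shadowing X f \<and>
           \<not> lipschitz_structurally_stable X f \<and>
           \<not> topologically_stable X f"
proof -
  have "Lip X contr \<le> ereal (inverse (real CARD('p)))"
    by (intro Lip_leI contr_lipschitz)
  also have "\<dots> < 1"
    using card_ge_2[where 'p='p] by (simp add: one_ereal_def field_simps)
  finally have "\<exists>R. R \<in> X \<rightarrow> X \<and> Lip X R < 1 \<and> (\<forall>x\<in>X. expand X (R x) = x)"
    using contr_mem[OF assms] expand_contr by (intro exI[of _ contr]) auto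
  then show ?thesis
    using expand_continuous[OF assms] expand_mem[OF assms] not_shadowing[OF assms]
      not_lipschitz_structurally_stable[OF assms] not_topologically_stable[OF assms]
    by (intro exI[of _ "expand X"]) auto
qed

end
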